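(* The collection $\{1324, 2314, 3214, 4213\}$ is inversion monotone; that is, $\mathrm{av}_n^k(1324,2314,3214,4213)\le \mathrm{av}_{n+1}^k(1324,2314,3214,4213)$ for all integers $n,k\ge 0$.
   Context: A permutation $\pi\in S_n$ contains a pattern $p \in S_m$ if $\pi$ (in one-line notation) has a subsequence order-isomorphic to $p$; otherwise $\pi$ avoids $p$. An inversion of $\pi$ is a pair $i<j$ with $\pi_i>\pi_j$. For a set $B$ of patterns, $\mathrm{av}_n^k(B)$ is the number of permutations in $S_n$ with exactly $k$ inversions that avoid every pattern in $B$. $B$ is called inversion monotone if $\mathrm{av}_n^k(B)\le \mathrm{av}_{n+1}^k(B)$ for all $n$ and $k$. *)

theory Defs
  imports "HOL-Combinatorics.Multiset_Permutations" "HOL-Library.Sublist"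
begin

(* Permutations and patterns are written in one-line notation, as lists: S_n is
   permutations_of_set {1..n}, and the pattern 1324 is [1, 3, 2, 4]. *)

definition order_isomorphic :: "'a::linorder list \<Rightarrow> 'b::linorder list \<Rightarrow> bool" where
  "order_isomorphic xs ys \<longleftrightarrow>
     length xs = length ys \<and>
     (\<forall>i<length xs. \<forall>j<length xs. xs ! i < xs ! j \<longleftrightarrow> ys ! i < ys ! j)"

definition contains_pattern :: "nat list \<Rightarrow> nat list \<Rightarrow> bool" where
  "contains_pattern \<pi> p \<longleftrightarrow> (\<exists>xs. subseq xs \<pi> \<and> order_isomorphic xs p)"

definition avoids :: "nat list \<Rightarrow> nat list \<Rightarrow> bool" where
  "avoids \<pi> p \<longleftrightarrow> \<not> contains_pattern \<pi> p"

definition inversions :: "nat list \<Rightarrow> (nat \<times> nat) set" where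
  "inversions \<pi> = {(i, j). i < j \<and> j < length \<pi> \<and> \<pi> ! i > \<pi> ! j}"

definition av :: "nat \<Rightarrow> nat \<Rightarrow> nat list set \<Rightarrow> nat" where
  "av n k B =
     card {\<pi> \<in> permutations_of_set {1..n}.
       card (inversions \<pi>) = k \<and> (\<forall>p\<in>B. avoids \<pi> p)}"

definition inversion_monotone :: "nat list set \<Rightarrow> bool" where
  "inversion_monotone B \<longleftrightarrow> (\<forall>n k. av n k B \<le> av (n + 1) k B)"

end

theory Submission
  imports Defs
begin

text \<open>
  The four patterns are exactly the patterns \<open>x b c d\<close> whose last three letters are
  order-isomorphic to \<open>213\<close>. Hence a permutation avoids all of them iff it avoids \<open>213\<close> after
  deletion of its first letter \<open>a\<close>, and this letter always takes part in \<open>a - 1\<close> inversions.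
  Putting a new minimum in front of a word creates neither inversions nor copies of \<open>213\<close>.
  Doing this to the word after \<open>a\<close>, and relabelling so that the first letter is still \<open>a\<close>,
  injects the avoiders in \<open>S\<^sub>n\<close> with \<open>k\<close> inversions into those in \<open>S\<^sub>n\<^sub>+\<^sub>1\<close>.
\<close>

lemma order_isomorphic_Nil [simp]: "order_isomorphic [] ys \<longleftrightarrow> ys = []"
  by (auto simp: order_isomorphic_def)

lemma order_isomorphic_Nil_right [simp]: "order_isomorphic xs [] \<longleftrightarrow> xs = []"
  by (auto simp: order_isomorphic_def)

lemma order_isomorphic_Cons:
  "order_isomorphic (x # xs) (y # ys) \<longleftrightarrow>
     order_isomorphic xs ys \<and>
     (\<forall>i<length xs. (x < xs ! i \<longleftrightarrow> y < ys ! i) \<and> (xs ! i < x \<longleftrightarrow> ys ! i < y))"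
  unfolding order_isomorphic_def by (auto simp: All_less_Suc2)

text \<open>Peels a concrete pattern letter by letter, so that simplification turns isomorphism to
  it into explicit comparisons.\<close>

lemma order_isomorphic_Cons_right:
  "order_isomorphic xs (y # ys) \<longleftrightarrow>
     (\<exists>x xs'. xs = x # xs' \<and> order_isomorphic xs' ys \<and>
       (\<forall>i<length xs'. (x < xs' ! i \<longleftrightarrow> y < ys ! i) \<and> (xs' ! i < x \<longleftrightarrow> ys ! i < y)))"
  by (cases xs) (simp_all add: order_isomorphic_Cons)

lemma contains_pattern_213_iff:
  "contains_pattern \<pi> [2, 1, 3] \<longleftrightarrow> (\<exists>b c d. subseq [b, c, d] \<pi> \<and> c < b \<and> b < d)"
proof -
  have "order_isomorphic xs [2, 1, 3 :: nat] \<longleftrightarrow> (\<exists>b c d. xs = [b, c, d] \<and> c < b \<and> b < d)"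
    for xs :: "nat list"
    by (auto simp: order_isomorphic_Cons_right All_less_Suc2)
  thus ?thesis by (auto simp: contains_pattern_def)
qed

lemma subseq_map_conv: "subseq xs (map f ys) \<longleftrightarrow> (\<exists>zs. subseq zs ys \<and> xs = map f zs)"
  by (auto simp: subseq_conv_nths nths_map)

text \<open>On the letters of \<open>xs\<close>, \<open>g\<close> both preserves and reflects the
  order, so copies of 213 correspond position by position.\<close>

lemma avoids_213_map:
  assumes "strict_mono_on (set xs) g"
  shows "avoids (map g xs) [2, 1, 3] \<longleftrightarrow> avoids xs [2, 1, 3]"
proof -
  have "(c < b \<longleftrightarrow> g c < g b) \<and> (b < d \<longleftrightarrow> g b < g d)" if "subseq [b, c, d] xs" for b c d
    using strict_mono_on_less[OF assms] list_emb_set[OF that] by auto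
  moreover have "contains_pattern (map g xs) [2, 1, 3] \<longleftrightarrow>
      (\<exists>b c d. subseq [b, c, d] xs \<and> g c < g b \<and> g b < g d)"
    unfolding contains_pattern_213_iff subseq_map_conv
    by (intro iffI; elim exE conjE; clarsimp simp: Cons_eq_map_conv; blast?)
  ultimately have "contains_pattern (map g xs) [2, 1, 3] \<longleftrightarrow> contains_pattern xs [2, 1, 3]"
    unfolding contains_pattern_213_iff by blast
  thus ?thesis by (simp add: avoids_def)
qed

text \<open>The first letter of a copy of 213 has a smaller letter to its right, so a leading
  minimum can only be skipped.\<close>

lemma avoids_213_Cons_min:
  assumes "\<forall>x\<in>set xs. m < x"
  shows "avoids (m # xs) [2, 1, 3] \<longleftrightarrow> avoids xs [2, 1, 3]"
proof -
  have "subseq [b, c, d] (m # xs) \<longleftrightarrow> subseq [b, c, d] xs" if "c < b" for b c d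
  proof
    assume sub: "subseq [b, c, d] (m # xs)"
    have "c \<in> set xs" if "subseq [c, d] xs"
      using list_emb_set[OF that] by auto
    hence "\<not> subseq [c, d] xs" if "b = m"
      using assms \<open>c < b\<close> that by fastforce
    thus "subseq [b, c, d] xs" using sub by (cases "b = m") auto
  qed (rule list_emb_Cons)
  thus ?thesis unfolding avoids_def contains_pattern_213_iff by blast
qed

lemma avoids_four_patterns_Cons_iff:
  assumes "a \<notin> set xs"
  shows "(\<forall>p\<in>{[1, 3, 2, 4], [2, 3, 1, 4], [3, 2, 1, 4], [4, 2, 1, 3]}. avoids (a # xs) p)
           \<longleftrightarrow> avoids xs [2, 1, 3]"
proof -
  let ?B = "{[1, 3, 2, 4], [2, 3, 1, 4], [3, 2, 1, 4], [4, 2, 1, 3]} :: nat list set"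
  have "contains_pattern xs [2, 1, 3]" if p: "p \<in> ?B" "contains_pattern (a # xs) p" for p
  proof -
    obtain ys where ys: "subseq ys (a # xs)" "order_isomorphic ys p"
      using p by (auto simp: contains_pattern_def)
    have "order_isomorphic (tl ys) [2, 1, 3 :: nat]"
      using p ys(2) by (auto simp: order_isomorphic_Cons_right All_less_Suc2)
    \<comment> \<open>Either the head of \<open>ys\<close> is matched with \<open>a\<close>, which
      leaves its tail in \<open>xs\<close>, or all of \<open>ys\<close> already lies in
      \<open>xs\<close>.\<close>
    moreover have "subseq (tl ys) xs"
      using ys(1) by (cases ys) (auto split: if_splits intro: subseq_Cons')
    ultimately show ?thesis by (auto simp: contains_pattern_def)
  qed
  moreover have "\<exists>p\<in>?B. contains_pattern (a # xs) p" if xs: "contains_pattern xs [2, 1, 3]"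
  proof -
    obtain b c d where bcd: "subseq [b, c, d] xs" "c < b" "b < d"
      using xs unfolding contains_pattern_213_iff by blast
    have "a \<noteq> b" "a \<noteq> c" "a \<noteq> d"
      using assms list_emb_set[OF bcd(1)] by auto
    \<comment> \<open>The letters \<open>c < b < d\<close> leave four gaps for \<open>a\<close>; in
      this order they yield 1324, 2314, 3214 and 4213.\<close>
    then consider "a < c" | "c < a" "a < b" | "b < a" "a < d" | "d < a"
      by linarith
    hence "order_isomorphic [a, b, c, d] [1, 3, 2, 4 :: nat] \<or>
        order_isomorphic [a, b, c, d] [2, 3, 1, 4 :: nat] \<or>
        order_isomorphic [a, b, c, d] [3, 2, 1, 4 :: nat] \<or>
        order_isomorphic [a, b, c, d] [4, 2, 1, 3 :: nat]"
      by cases (use bcd(2,3) in \<open>simp_all add: order_isomorphic_Cons All_less_Suc2\<close>)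
    hence "\<exists>p\<in>?B. order_isomorphic [a, b, c, d] p" by blast
    moreover have "subseq [a, b, c, d] (a # xs)" using bcd(1) by simp
    ultimately show ?thesis unfolding contains_pattern_def by blast
  qed
  ultimately show ?thesis unfolding avoids_def by blast
qed

lemma inversions_subset: "inversions xs \<subseteq> {..<length xs} \<times> {..<length xs}"
  by (auto simp: inversions_def)

lemma finite_inversions [simp]: "finite (inversions xs)"
  using finite_subset[OF inversions_subset] by auto

text \<open>Inversions split by whether they use position 0; the others are those of
  \<open>xs\<close> with both positions shifted by one. Distinctness lets smaller letters be counted
  by value instead of by position.\<close>

lemma card_inversions_Cons:
  assumes "distinct xs"
  shows "card (inversions (x # xs)) = card {y \<in> set xs. y < x} + card (inversions xs)"
proof -
  let ?J = "{j. j < length xs \<and> xs ! j < x}"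
  have "inversions (x # xs) = (\<lambda>j. (0, Suc j)) ` ?J \<union> map_prod Suc Suc ` inversions xs"
    (is "?L = ?R")
  proof (intro set_eqI)
    fix z :: "nat \<times> nat"
    obtain i j where "z = (i, j)" by fastforce
    thus "z \<in> ?L \<longleftrightarrow> z \<in> ?R"
      by (cases i; cases j) (auto simp: inversions_def)
  qed
  moreover have "card ((\<lambda>j. (0 :: nat, Suc j)) ` ?J) = card ?J"
    by (intro card_image) (auto simp: inj_on_def)
  moreover have "card (map_prod Suc Suc ` inversions xs) = card (inversions xs)"
    by (intro card_image) (auto simp: inj_on_def)
  moreover have "card {y \<in> set xs. y < x} = card ?J"
  proof -
    have "{y \<in> set xs. y < x} = (!) xs ` ?J" by (auto simp: in_set_conv_nth)
    moreover have "inj_on ((!) xs) ?J" using assms by (auto simp: inj_on_def nth_eq_iff_index_eq)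
    ultimately show ?thesis by (simp add: card_image)
  qed
  moreover have "(\<lambda>j. (0, Suc j)) ` ?J \<inter> map_prod Suc Suc ` inversions xs = {}" by auto
  ultimately show ?thesis by (simp add: card_Un_disjoint)
qed

lemma inversions_map:
  assumes "strict_mono_on (set xs) g"
  shows "inversions (map g xs) = inversions xs"
  using strict_mono_on_less[OF assms] by (auto simp: inversions_def)

text \<open>All of the values \<open>1, ..., a - 1\<close> come after the leading \<open>a\<close>.
  Its contribution is independent of \<open>n\<close>, so it can be compared across lengths.\<close>

lemma card_inversions_perm_Cons:
  assumes "a # xs \<in> permutations_of_set {1..n}"
  shows "card (inversions (a # xs)) = a - 1 + card (inversions xs)"
proof -
  have a: "a \<in> {1..n}" and xs: "distinct xs" "set xs = {1..n} - {a}"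
    using assms by (auto simp: permutations_of_set_def)
  have "{y \<in> set xs. y < a} = {1..<a}" using a by (auto simp: xs(2))
  thus ?thesis using card_inversions_Cons[OF xs(1)] by simp
qed

text \<open>
  On the letters other than \<open>a\<close>, the relabelling \<open>x \<mapsto> shift_around a x\<close> is increasing and avoids
  both \<open>a\<close> and the smallest value different from \<open>a\<close>, which is free for the new minimum.
\<close>

definition shift_around :: "nat \<Rightarrow> nat \<Rightarrow> nat" where
  "shift_around a x = (if Suc x = a then Suc a else Suc x)"

definition new_min :: "nat \<Rightarrow> nat" where
  "new_min a = (if a = 1 then 2 else 1)"

text \<open>The empty word has no first letter to keep; it goes to the only permutation of
  \<open>{1..1}\<close>.\<close>

fun extend :: "nat list \<Rightarrow> nat list" where
  "extend [] = [1]"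
| "extend (a # xs) = a # new_min a # map (shift_around a) xs"

text \<open>The relabelling is the successor map except that \<open>a - 1\<close> jumps over
  \<open>a\<close> to \<open>a + 1\<close>. That value is otherwise taken only at \<open>a\<close>
  itself, which is excluded.\<close>

lemma strict_mono_on_shift_around: "a \<notin> A \<Longrightarrow> strict_mono_on A (shift_around a)"
  unfolding strict_mono_on_def shift_around_def by (metis Suc_lessI Suc_mono less_SucI)

lemma new_min_less_shift_around: "0 < x \<Longrightarrow> x \<noteq> a \<Longrightarrow> new_min a < shift_around a x"
  by (auto simp: new_min_def shift_around_def)

lemma new_min_neq: "new_min a \<noteq> a"
  by (simp add: new_min_def)

lemma shift_around_neq: "shift_around a x \<noteq> a"
  by (auto simp: shift_around_def)

lemma extend_in_permutations:
  assumes "\<pi> \<in> permutations_of_set {1..n}"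
  shows "extend \<pi> \<in> permutations_of_set {1..n + 1}"
proof (cases \<pi>)
  case Nil
  thus ?thesis using assms by (auto simp: permutations_of_set_def)
next
  case (Cons a xs)
  have a: "1 \<le> a" "a \<le> n" "a \<notin> set xs" and xs: "distinct xs" "set xs = {1..n} - {a}"
    and len: "Suc (length xs) = n"
    using assms distinct_card[of \<pi>] unfolding Cons by (auto simp: permutations_of_set_def)
  have mono: "strict_mono_on (set xs) (shift_around a)"
    using a(3) by (rule strict_mono_on_shift_around)
  have "new_min a < y" if "y \<in> shift_around a ` set xs" for y
    using that by (auto simp: xs(2) intro: new_min_less_shift_around)
  hence "new_min a \<notin> shift_around a ` set xs" by blast
  hence dist: "distinct (extend \<pi>)"
    using xs(1) strict_mono_on_imp_inj_on[OF mono]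
      new_min_neq[of a] shift_around_neq[of a]
    by (auto simp: Cons distinct_map dest: sym[of a])
  \<comment> \<open>Inclusion suffices: \<open>n + 1\<close> distinct letters inside
    \<open>{1..n + 1}\<close> must fill it.\<close>
  have "set (extend \<pi>) \<subseteq> {1..n + 1}"
    using a(1,2) by (auto simp: Cons xs(2) new_min_def shift_around_def)
  moreover have "card (set (extend \<pi>)) = n + 1"
    using distinct_card[OF dist] len by (simp only: Cons extend.simps list.size length_map)
  ultimately have "set (extend \<pi>) = {1..n + 1}" by (intro card_subset_eq) auto
  thus ?thesis using dist by (simp add: permutations_of_set_def)
qed

text \<open>The first letter survives as the first letter of the image, so it is known which
  relabelling to undo.\<close>

lemma inj_on_extend: "inj_on extend (permutations_of_set A)"
proof (rule inj_onI)
  fix \<pi> \<sigma> assume perms: "\<pi> \<in> permutations_of_set A" "\<sigma> \<in> permutations_of_set A"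
    and eq: "extend \<pi> = extend \<sigma>"
  show "\<pi> = \<sigma>"
  proof (cases \<pi>)
    case Nil
    \<comment> \<open>Here \<open>A\<close> is empty, which forces the other word to be empty
      too.\<close>
    thus ?thesis using perms by (simp add: permutations_of_set_def)
  next
    case (Cons a xs)
    then obtain ys where \<sigma>: "\<sigma> = a # ys" and maps: "map (shift_around a) xs = map (shift_around a) ys"
      using eq by (cases \<sigma>) auto
    have "a \<notin> set xs \<union> set ys"
      using perms by (auto simp: Cons \<sigma> permutations_of_set_def)
    hence "inj_on (shift_around a) (set xs \<union> set ys)"
      by (intro strict_mono_on_imp_inj_on strict_mono_on_shift_around)
    thus ?thesis using maps by (simp add: Cons \<sigma> inj_on_map_eq_map)
  qed
qed

theorem proposition4p3:
  shows "inversion_monotone {[1, 3, 2, 4], [2, 3, 1, 4], [3, 2, 1, 4], [4, 2, 1, 3]}"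
proof -
  let ?B = "{[1, 3, 2, 4], [2, 3, 1, 4], [3, 2, 1, 4], [4, 2, 1, 3]} :: nat list set"
  have main: "card (inversions (extend \<pi>)) = card (inversions \<pi>) \<and> (\<forall>p\<in>?B. avoids (extend \<pi>) p)"
    if perm: "\<pi> \<in> permutations_of_set {1..n}" and av: "\<forall>p\<in>?B. avoids \<pi> p" for n \<pi>
  proof (cases \<pi>)
    case Nil
    have "avoids [] [2, 1, 3]" unfolding avoids_def contains_pattern_213_iff by simp
    hence "\<forall>p\<in>?B. avoids [1] p" by (subst avoids_four_patterns_Cons_iff) auto
    moreover have "inversions [1] = {}" "inversions [] = {}" by (auto simp: inversions_def)
    ultimately show ?thesis by (simp add: Nil)
  next
    case (Cons a xs)
    define ys where "ys = new_min a # map (shift_around a) xs"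
    have ext: "extend \<pi> = a # ys" by (simp add: Cons ys_def)
    have ext_perm: "a # ys \<in> permutations_of_set {1..n + 1}"
      using extend_in_permutations[OF perm] by (simp only: ext)
    hence ys: "a \<notin> set ys" "distinct ys" by (auto simp: permutations_of_set_def)
    have xs: "a \<notin> set xs" "set xs \<subseteq> {1..n}"
      using perm by (auto simp: Cons permutations_of_set_def)
    have mono: "strict_mono_on (set xs) (shift_around a)"
      using xs(1) by (rule strict_mono_on_shift_around)
    have min: "\<forall>y\<in>set (map (shift_around a) xs). new_min a < y"
      using xs by (auto intro!: new_min_less_shift_around)
    hence no_smaller: "{y \<in> set (map (shift_around a) xs). y < new_min a} = {}"
      using less_asym by blast
    have "card (inversions ys) = card (inversions xs)"
      using ys(2) card_inversions_Cons[of "map (shift_around a) xs" "new_min a"]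
      unfolding ys_def no_smaller inversions_map[OF mono] by simp
    \<comment> \<open>The same first letter \<open>a\<close> contributes \<open>a - 1\<close> on
      both sides, and the remainders \<open>ys\<close> and \<open>xs\<close> have equally many
      inversions.\<close>
    hence "card (inversions (extend \<pi>)) = card (inversions \<pi>)"
      using card_inversions_perm_Cons[OF ext_perm] card_inversions_perm_Cons[OF perm[unfolded Cons]]
      by (simp only: ext flip: Cons)
    moreover have "avoids ys [2, 1, 3]"
      using av unfolding Cons avoids_four_patterns_Cons_iff[OF xs(1)] ys_def
        avoids_213_Cons_min[OF min] avoids_213_map[OF mono] .
    hence "\<forall>p\<in>?B. avoids (extend \<pi>) p"
      unfolding ext avoids_four_patterns_Cons_iff[OF ys(1)] .
    ultimately show ?thesis by blast
  qed
  show ?thesis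
    unfolding inversion_monotone_def av_def
  proof (intro allI card_inj_on_le[where f = extend])
    fix n k
    show "inj_on extend {\<pi> \<in> permutations_of_set {1..n}.
        card (inversions \<pi>) = k \<and> (\<forall>p\<in>?B. avoids \<pi> p)}"
      by (rule inj_on_subset[OF inj_on_extend]) auto
    show "extend ` {\<pi> \<in> permutations_of_set {1..n}.
        card (inversions \<pi>) = k \<and> (\<forall>p\<in>?B. avoids \<pi> p)}
      \<subseteq> {\<pi> \<in> permutations_of_set {1..n + 1}.
        card (inversions \<pi>) = k \<and> (\<forall>p\<in>?B. avoids \<pi> p)}"
      using main extend_in_permutations by blast
  qed simp
qed

end
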